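(* Let $n$ and $d$ be integers with $n > d+1 \geq 3$, and let $\mathbf{x} = (x_0,\dots,x_n)$ be equally spaced nodes $x_i = x_0 + ih$, $h>0$. Let $\tilde{\Lambda}_{\mathbf{x},d,d,d}$ be the Lebesgue constant of the extended Floater-Hormann interpolant $\tilde r_{\mathbf{x},d,\tilde n,\tilde d}$ with parameters $\tilde n = \tilde d = d$, and let $\Lambda_d$ be the Lebesgue constant of polynomial interpolation at $d+1$ equally spaced nodes. Then $$\tilde{\Lambda}_{\mathbf{x},d,d,d} \;\geq\; \kappa_d\, \Lambda_d, \qquad \text{where} \qquad \kappa_d := 1 - \frac{d}{2^d-1} - 2^{-d}.$$
   Context: Usual Floater-Hormann interpolants. For equally spaced nodes $\mathbf{z}=(z_0,\dots,z_m)$, an integer $0\le\delta\le m$ and values $\mathbf{v}=(v_0,\dots,v_m)\in\mathbb{R}^{m+1}$, put $$r_{\mathbf{z},\delta}[\mathbf{v}](t) = \left.\sum_{i=0}^{m}\frac{w_{m,\delta,i}\,v_i}{t-z_i}\right/\sum_{i=0}^{m}\frac{w_{m,\delta,i}}{t-z_i},\qquad w_{m,\delta,i} = (-1)^{i-\delta}\sum_{j=\max\{0,i-\delta\}}^{\min\{m-\delta,i\}}\binom{\delta}{i-j},$$ extended by continuity to the nodes, where $r_{\mathbf{z},\delta}[\mathbf{v}](z_i)=v_i$. This rational function has no real poles. $r^{(k)}_{\mathbf{z},\delta}[\mathbf{v}]$ denotes its $k$th derivative. Extended Floater-Hormann interpolants. Let $\mathbf{x}=(x_0,\dots,x_n)$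 with $x_i=x_0+ih$, $h>0$, let $\mathbf{y}=(y_0,\dots,y_n)\in\mathbb{R}^{n+1}$, let $d\ge 0$ and $0\le\tilde d\le\tilde n\le n$ be integers. Let $\tilde x_i = x_0+ih$ for $-d\le i\le n+d$, and let $\underline{\mathbf{x}}=(x_0,\dots,x_{\tilde n})$, $\underline{\mathbf{y}}=(y_0,\dots,y_{\tilde n})$, $\overline{\mathbf{x}}=(x_{n-\tilde n},\dots,x_n)$, $\overline{\mathbf{y}}=(y_{n-\tilde n},\dots,y_n)$. Define the extended function values $$\tilde y_i := y_0+\sum_{k=1}^{\tilde d} r^{(k)}_{\underline{\mathbf{x}},\tilde d}[\underline{\mathbf{y}}](x_0)\frac{(\tilde x_i-x_0)^k}{k!}\quad (-d\le i<0),\qquad \tilde y_i:=y_i\quad(0\le i\le n),$$ $$\tilde y_i := y_n+\sum_{k=1}^{\tilde d} r^{(k)}_{\overline{\mathbf{x}},\tilde d}[\overline{\mathbf{y}}](x_n)\frac{(\tilde x_i-x_n)^k}{k!}\quad (n<i\le n+d).$$ The extended interpolant is $$\tilde r_{\mathbf{x},d,\tilde n,\tilde d}[\mathbf{y}](t) = \left.\sum_{i=-d}^{n+d}\frac{\tilde w_{n,d,i}\,\tilde y_i}{t-\tilde x_i}\right/\sum_{i=-d}^{n+d}\frac{\tilde w_{n,d,i}}{t-\tilde x_i},\qquad \tilde w_{n,d,i}:=w_{n+2d,d,i+d}=(-1)^i\sum_{j=\max\{0,i\}}^{\min\{n+d,i+d\}}\binom{d}{i+d-j},$$ extended by continuity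 to the nodes $\tilde x_i$ (with value $\tilde y_i$ there). Lebesgue constants. $$\tilde\Lambda_{\mathbf{x},d,\tilde n,\tilde d} := \max_{x_0\le t\le x_n}\ \sup_{\|\mathbf{y}\|_\infty=1}\left|\tilde r_{\mathbf{x},d,\tilde n,\tilde d}[\mathbf{y}](t)\right|,\qquad \Lambda_d := \sup_{0\le t\le d,\ \mathbf{y}\in\mathbb{R}^{d+1}\setminus\{0\}}\frac{|p_{d,\mathbf{y}}(t)|}{\|\mathbf{y}\|_\infty},$$ where $\mathbf{y}$ on the left ranges over $\mathbb{R}^{n+1}$, and $p_{d,\mathbf{y}}$ is the polynomial of degree less than $d+1$ with $p_{d,\mathbf{y}}(i)=y_i$ for $i=0,\dots,d$. *)

theory Defs
  imports "HOL-Analysis.Analysis" "HOL-Computational_Algebra.Computational_Algebra"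
begin

(* At a node the quotient is replaced by its limit, the prescribed value; see
   bary_tendsto_node below. *)
definition bary :: "'i set \<Rightarrow> ('i \<Rightarrow> real) \<Rightarrow> ('i \<Rightarrow> real) \<Rightarrow> ('i \<Rightarrow> real) \<Rightarrow> real \<Rightarrow> real" where
  "bary I w z v t =
     (if \<exists>i\<in>I. t = z i then v (THE i. i \<in> I \<and> t = z i)
      else (\<Sum>i\<in>I. w i * v i / (t - z i)) / (\<Sum>i\<in>I. w i / (t - z i)))"

(* The truncated difference i - \<delta> is the lower summation bound max {0, i - \<delta>}. *)
definition fh_weight :: "nat \<Rightarrow> nat \<Rightarrow> nat \<Rightarrow> real" where
  "fh_weight m \<delta> i =
     (-1) powi (int i - int \<delta>) * (\<Sum>j\<in>{i - \<delta>..min (m - \<delta>) i}. real (\<delta> choose (i - j)))"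

definition fh_interp :: "nat \<Rightarrow> nat \<Rightarrow> (nat \<Rightarrow> real) \<Rightarrow> (nat \<Rightarrow> real) \<Rightarrow> real \<Rightarrow> real" where
  "fh_interp m \<delta> z v = bary {0..m} (fh_weight m \<delta>) z v"

definition node :: "real \<Rightarrow> real \<Rightarrow> int \<Rightarrow> real" where
  "node x0 h i = x0 + of_int i * h"

(* A vector (y_0,...,y_n) is given by a function on nat, of which only the values at
   0,...,n are used. The parameters nt and dt are meant with dt \<le> nt \<le> n. *)
definition ext_val ::
  "real \<Rightarrow> real \<Rightarrow> nat \<Rightarrow> nat \<Rightarrow> nat \<Rightarrow> (nat \<Rightarrow> real) \<Rightarrow> int \<Rightarrow> real" where
  "ext_val x0 h n nt dt y i =
     (if i < 0 then
        y 0 + (\<Sum>k=1..dt.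
          (deriv ^^ k) (fh_interp nt dt (\<lambda>j. node x0 h (int j)) y) (node x0 h 0)
            * (node x0 h i - node x0 h 0) ^ k / fact k)
      else if i \<le> int n then y (nat i)
      else
        y n + (\<Sum>k=1..dt.
          (deriv ^^ k) (fh_interp nt dt (\<lambda>j. node x0 h (int (n - nt + j))) (\<lambda>j. y (n - nt + j)))
              (node x0 h (int n))
            * (node x0 h i - node x0 h (int n)) ^ k / fact k))"

definition ext_weight :: "nat \<Rightarrow> nat \<Rightarrow> int \<Rightarrow> real" where
  "ext_weight n d i = fh_weight (n + 2 * d) d (nat (i + int d))"

definition ext_fh_interp ::
  "real \<Rightarrow> real \<Rightarrow> nat \<Rightarrow> nat \<Rightarrow> nat \<Rightarrow> nat \<Rightarrow> (nat \<Rightarrow> real) \<Rightarrow> real \<Rightarrow> real" where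
  "ext_fh_interp x0 h n d nt dt y =
     bary {- int d..int n + int d} (ext_weight n d) (node x0 h) (ext_val x0 h n nt dt y)"

definition max_norm :: "nat \<Rightarrow> (nat \<Rightarrow> real) \<Rightarrow> real" where
  "max_norm n y = Max ((\<lambda>i. \<bar>y i\<bar>) ` {0..n})"

definition ext_lebesgue :: "real \<Rightarrow> real \<Rightarrow> nat \<Rightarrow> nat \<Rightarrow> nat \<Rightarrow> nat \<Rightarrow> real" where
  "ext_lebesgue x0 h n d nt dt =
     (SUP t\<in>{node x0 h 0..node x0 h (int n)}.
        SUP y\<in>{y. max_norm n y = 1}. \<bar>ext_fh_interp x0 h n d nt dt y t\<bar>)"

definition interp_poly :: "nat \<Rightarrow> (nat \<Rightarrow> real) \<Rightarrow> real poly" where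
  "interp_poly d y = (THE p. degree p < d + 1 \<and> (\<forall>i\<in>{0..d}. poly p (real i) = y i))"

definition poly_lebesgue :: "nat \<Rightarrow> real" where
  "poly_lebesgue d =
     (SUP (t, y)\<in>{0..real d} \<times> {y. \<exists>i\<in>{0..d}. y i \<noteq> 0}.
        \<bar>poly (interp_poly d y) t\<bar> / max_norm d y)"

definition kappa :: "nat \<Rightarrow> real" where
  "kappa d = 1 - real d / (2 ^ d - 1) - 2 powi (- int d)"

lemma ext_weight_eq:
  assumes "- int d \<le> i"
  shows "ext_weight n d i =
    (-1) powi i * (\<Sum>j\<in>{max 0 i..min (int n + int d) (i + int d)}. real (d choose nat (i + int d - j)))"
proof -
  have "(\<Sum>j\<in>{nat (i + int d) - d..min (n + 2 * d - d) (nat (i + int d))}.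
           real (d choose (nat (i + int d) - j)))
      = (\<Sum>j\<in>{max 0 i..min (int n + int d) (i + int d)}. real (d choose nat (i + int d - j)))"
    by (rule sum.reindex_bij_witness[of _ nat int])
       (use assms in \<open>auto simp: nat_diff_distrib nat_le_iff le_nat_iff\<close>)
  then show ?thesis
    using assms by (simp add: ext_weight_def fh_weight_def)
qed

lemma bary_node:
  assumes "inj_on z I" "i \<in> I"
  shows "bary I w z v (z i) = v i"
proof -
  have "(THE j. j \<in> I \<and> z i = z j) = i"
    using assms by (auto dest: inj_onD)
  then show ?thesis
    using assms(2) by (auto simp: bary_def)
qed

lemma bary_tendsto_node:
  fixes z w v :: "'i \<Rightarrow> real"
  assumes "finite I" "inj_on z I" "i \<in> I" "w i \<noteq> 0"
  shows "((\<lambda>t. (\<Sum>j\<in>I. w j * v j / (t - z j)) / (\<Sum>j\<in>I. w j / (t - z j))) \<longlongrightarrow> v i) (at (z i))"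
proof -
  have ne: "z i \<noteq> z j" if "j \<in> I - {i}" for j
    using that assms(2,3) by (auto dest: inj_onD)
  let ?N = "\<lambda>c t. c i + (t - z i) * (\<Sum>j\<in>I - {i}. c j / (t - z j))"
  have lim: "(?N c \<longlongrightarrow> c i + (z i - z i) * (\<Sum>j\<in>I - {i}. c j / (z i - z j))) (at (z i))" for c
    by (intro tendsto_intros) (use ne in auto)
  have "((\<lambda>t. ?N (\<lambda>j. w j * v j) t / ?N w t) \<longlongrightarrow> v i) (at (z i))"
    using tendsto_divide[OF lim[of "\<lambda>j. w j * v j"] lim[of w]] assms(4) by simp
  moreover have "?N (\<lambda>j. w j * v j) t / ?N w t
      = (\<Sum>j\<in>I. w j * v j / (t - z j)) / (\<Sum>j\<in>I. w j / (t - z j))" if "t \<noteq> z i" for t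
  proof -
    have "(\<Sum>j\<in>I. c j / (t - z j)) = ?N c t / (t - z i)" for c
      using that assms(1,3) by (simp add: sum.remove[of I i] field_simps)
    then show ?thesis
      using that by simp
  qed
  ultimately show ?thesis
    by (elim Lim_transform_eventually) (auto simp: eventually_at_filter)
qed

lemma interp_poly_unique_exists:
  "\<exists>!p :: real poly. degree p < d + 1 \<and> (\<forall>i\<in>{0..d}. poly p (real i) = y i)"
proof (rule ex_ex1I)
  define L where "L i = (\<Prod>j\<in>{0..d} - {i}. [:- real j, 1:])" for i
  let ?p = "\<Sum>i\<in>{0..d}. smult (y i / poly (L i) (real i)) (L i)"
  have L0: "poly (L i) (real k) = 0" if "k \<in> {0..d}" "k \<noteq> i" for i k
    using that by (auto simp: L_def poly_prod prod_zero_iff)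
  have L1: "poly (L i) (real i) \<noteq> 0" for i
    by (auto simp: L_def poly_prod prod_zero_iff)
  have "degree (L i) \<le> d" if "i \<in> {0..d}" for i
  proof -
    have "degree (L i) \<le> sum (degree \<circ> (\<lambda>j. [:- real j, 1:])) ({0..d} - {i})"
      unfolding L_def by (rule degree_prod_sum_le) simp
    then show ?thesis using that by simp
  qed
  then have "degree ?p \<le> d"
    by (intro degree_sum_le) (auto intro: order_trans[OF degree_smult_le])
  moreover have "poly ?p (real k) = y k" if "k \<in> {0..d}" for k
  proof -
    have "poly ?p (real k) = (\<Sum>i\<in>{0..d}. if i = k then y k else 0)"
      unfolding poly_sum by (rule sum.cong) (use that L0 L1 in auto)
    then show ?thesis using that by simp
  qed
  ultimately show "\<exists>p. degree p < d + 1 \<and> (\<forall>i\<in>{0..d}. poly p (real i) = y i)"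
    by (intro exI[of _ ?p]) auto
next
  fix p q :: "real poly"
  assume pq: "degree p < d + 1 \<and> (\<forall>i\<in>{0..d}. poly p (real i) = y i)"
    "degree q < d + 1 \<and> (\<forall>i\<in>{0..d}. poly q (real i) = y i)"
  show "p = q"
  proof (rule ccontr)
    assume "p \<noteq> q"
    then have nz: "p - q \<noteq> 0" by simp
    have "real ` {0..d} \<subseteq> {x. poly (p - q) x = 0}"
      using pq by auto
    then have "card (real ` {0..d}) \<le> card {x. poly (p - q) x = 0}"
      by (intro card_mono poly_roots_finite nz)
    also have "\<dots> \<le> degree (p - q)"
      by (rule card_poly_roots_bound[OF nz])
    also have "\<dots> < d + 1"
      using pq by (intro degree_diff_less) auto
    finally show False
      by (simp add: card_image inj_on_def)
  qed
qed

end

theory Submission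
  imports Defs
begin

text \<open>
  With degree $d$ the extension polynomials at both ends are the interpolation polynomials at the
  outermost $d + 1$ nodes, and $\tilde r$ is a blend of local interpolation polynomials with
  coefficients $(-1)^a / \prod_j (u - a - j)$, where $u = (t - x_0)/h + d$ and $a = 0, \dots, n + d$.
  For $t$ in the first interval all blended polynomials with $a \le d$ equal the polynomial $p$
  interpolating $y_0, \dots, y_d$, and the blending coefficients are positive for $a \le d + 1$ and
  alternating with decreasing modulus afterwards. Take $y_k = (-1)^k \mathrm{sgn}(t - x_k)$ for
  $k \le d$ and $y_k = 0$ otherwise. Then $p(t)$ is the value of the Lebesgue function of polynomial
  interpolation, and every other contribution to the numerator is nonnegative. The denominator
  exceeds the sum $S$ of the coefficients with $a \le d$ by at most the coefficient with $a = d + 1$,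
  which is at most $S d / (2^d - 1)$. Finally, the Lebesgue function of polynomial interpolation at
  equally spaced nodes is largest in the outermost intervals.
\<close>

section \<open>Interpolation polynomials and blending\<close>

definition nodal :: "nat \<Rightarrow> real \<Rightarrow> real" where
  "nodal d s = (\<Prod>j\<le>d. s - real j)"

text \<open>The Lagrange basis polynomial for the nodes 0, ..., d. Its constant is the reciprocal of
  the product of all k - j with j \<noteq> k, written with a binomial to match the Floater-Hormann
  weights; d + k has the parity of d - k.\<close>

definition lagr :: "nat \<Rightarrow> nat \<Rightarrow> real poly" where
  "lagr d k = smult ((-1) ^ (d + k) * real (d choose k) / fact d)
     (\<Prod>j\<in>{..d} - {k}. [:- real j, 1:])"

lemma nodal_eq_0_iff: "nodal d s = 0 \<longleftrightarrow> (\<exists>j\<le>d. s = real j)"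
  by (auto simp: nodal_def)

text \<open>Both sides are the product of the d + 2 consecutive factors s + 1, s, ..., s -
  d.\<close>

lemma nodal_shift: "nodal d (s + 1) * (s - real d) = nodal d s * (s + 1)"
proof (induction d)
  case (Suc d)
  have "nodal (Suc d) (s + 1) * (s - real (Suc d))
      = (nodal d (s + 1) * (s - real d)) * (s - real (Suc d))"
    by (simp add: nodal_def)
  also have "\<dots> = nodal (Suc d) s * (s + 1)"
    unfolding Suc by (simp add: nodal_def)
  finally show ?case .
qed (simp add: nodal_def)

lemma nodal_reflect: "nodal d (real d - s) = (-1) ^ (d + 1) * nodal d s"
proof -
  have "nodal d (real d - s) = (\<Prod>j\<le>d. (real d - s) - real (d - j))"
    unfolding nodal_def by (rule prod.reindex_bij_witness[of _ "\<lambda>j. d - j" "\<lambda>j. d - j"]) auto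
  also have "\<dots> = (\<Prod>j\<le>d. (-1) * (s - real j))"
    by (rule prod.cong) (auto simp: of_nat_diff)
  finally show ?thesis
    unfolding prod.distrib by (simp add: nodal_def)
qed

text \<open>With e nodes to the right of k, the induction appends these one by one: the factors with
  j < k give \<open>fact k\<close>, those with j > k give the sign and
  \<open>fact e\<close>.\<close>

lemma prod_node_differences:
  "(\<Prod>j\<in>{..k + e} - {k}. real k - real j) = (-1) ^ e * fact k * fact e"
proof (induction e)
  case 0
  have "(\<Prod>j\<in>{..k} - {k}. real k - real j) = (\<Prod>j<k. real (k - j))"
    by (rule prod.cong) auto
  also have "\<dots> = fact k"
    unfolding fact_prod_rev lessThan_atLeast0 by simp
  finally show ?case by simp
next
  case (Suc e)
  have "{..k + Suc e} - {k} = insert (k + Suc e) ({..k + e} - {k})"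
    by auto
  then have "(\<Prod>j\<in>{..k + Suc e} - {k}. real k - real j)
      = (real k - real (k + Suc e)) * (\<Prod>j\<in>{..k + e} - {k}. real k - real j)"
    by simp
  then show ?case
    unfolding Suc by (simp add: algebra_simps)
qed

lemma poly_lagr_node:
  assumes "k \<le> d" "j \<le> d"
  shows "poly (lagr d k) (real j) = (if j = k then 1 else 0)"
proof (cases "j = k")
  case True
  obtain e where d: "d = k + e"
    using assms(1) le_Suc_ex by blast
  have "poly (lagr d k) (real k) = (-1) ^ (d + k) * real (d choose k) / fact d * ((-1) ^ e * fact k * fact e)"
    by (simp add: lagr_def poly_prod d prod_node_differences)
  also have "\<dots> = ((-1) ^ (d + k) * (-1) ^ e) * (fact k * fact (d - k) * real (d choose k) / fact d)"
    by (simp add: d mult_ac)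
  also have "fact k * fact (d - k) * real (d choose k) = fact d"
    using assms(1) by (simp add: binomial_fact)
  also have "(-1 :: real) ^ (d + k) * (-1) ^ e = 1"
    by (simp add: d minus_one_power_iff)
  finally have "poly (lagr d k) (real k) = 1"
    by simp
  then show ?thesis
    using True by simp
next
  case False
  then show ?thesis
    using assms by (auto simp: lagr_def poly_prod prod_zero_iff)
qed

lemma degree_lagr:
  assumes "k \<le> d"
  shows "degree (lagr d k) \<le> d"
proof -
  have "degree (\<Prod>j\<in>{..d} - {k}. [:- real j, 1:]) \<le> sum (degree \<circ> (\<lambda>j. [:- real j, 1:])) ({..d} - {k})"
    by (rule degree_prod_sum_le) simp
  also have "\<dots> = d"
    using assms by simp
  finally show ?thesis
    unfolding lagr_def by (meson degree_smult_le order_trans)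
qed

lemma poly_lagr:
  assumes "k \<le> d" "s \<noteq> real k"
  shows "poly (lagr d k) s = nodal d s * ((-1) ^ (d + k) * real (d choose k)) / (fact d * (s - real k))"
proof -
  have "nodal d s = (s - real k) * (\<Prod>j\<in>{..d} - {k}. s - real j)"
    unfolding nodal_def using assms(1) by (subst prod.remove[of _ k]) auto
  then show ?thesis
    using assms by (simp add: lagr_def poly_prod)
qed

lemma interp_poly_eqI:
  assumes "degree p \<le> d" "\<And>i. i \<le> d \<Longrightarrow> poly p (real i) = y i"
  shows "interp_poly d y = p"
  unfolding interp_poly_def
  by (rule the1_equality[OF interp_poly_unique_exists]) (use assms in auto)

lemma interp_poly_lagr: "interp_poly d y = (\<Sum>k\<le>d. smult (y k) (lagr d k))"
proof (rule interp_poly_eqI)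
  show "degree (\<Sum>k\<le>d. smult (y k) (lagr d k)) \<le> d"
    by (intro degree_sum_le) (auto intro!: degree_lagr)
  show "poly (\<Sum>k\<le>d. smult (y k) (lagr d k)) (real i) = y i" if "i \<le> d" for i
    using that by (simp add: poly_sum poly_lagr_node if_distrib sum.delta cong: if_cong)
qed

lemma poly_interp_poly: "poly (interp_poly d y) s = (\<Sum>k\<le>d. y k * poly (lagr d k) s)"
  by (simp add: interp_poly_lagr poly_sum)

lemma poly_interp_poly_node: "i \<le> d \<Longrightarrow> poly (interp_poly d y) (real i) = y i"
  by (simp add: poly_interp_poly poly_lagr_node if_distrib sum.delta cong: if_cong)

lemma degree_interp_poly: "degree (interp_poly d y) \<le> d"
  using theI'[OF interp_poly_unique_exists, of d y] unfolding interp_poly_def[symmetric] by simp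

text \<open>Uniqueness of interpolation in a shifted variable. It identifies the local interpolant
  of a window of consecutive nodes whose data all lie on one polynomial.\<close>

lemma interp_poly_of_poly:
  assumes "degree p \<le> d" "\<And>j. j \<le> d \<Longrightarrow> v j = poly p (c + real j)"
  shows "poly (interp_poly d v) s = poly p (c + s)"
proof -
  have "interp_poly d v = pcompose p [:c, 1:]"
    by (rule interp_poly_eqI) (use assms in \<open>auto simp: poly_pcompose degree_pcompose\<close>)
  then show ?thesis
    by (simp add: poly_pcompose)
qed

lemma sum_lagr: "(\<Sum>k\<le>d. poly (lagr d k) s) = 1"
  using interp_poly_of_poly[of 1 d "\<lambda>_. 1" 0 s] by (simp add: poly_interp_poly)

section \<open>Barycentric sums and blends of local interpolation polynomials\<close>

lemma barycentric_sum:
  assumes "\<And>j. j \<le> d \<Longrightarrow> s \<noteq> real j"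
  shows "(\<Sum>j\<le>d. (-1) ^ (d + j) * real (d choose j) * v j / (s - real j))
       = fact d / nodal d s * poly (interp_poly d v) s"
proof -
  have "nodal d s \<noteq> 0"
    using assms by (auto simp: nodal_eq_0_iff)
  then show ?thesis
    unfolding poly_interp_poly sum_distrib_left
    by (intro sum.cong) (use assms in \<open>auto simp: poly_lagr field_simps\<close>)
qed

text \<open>The weight of node k is a sum over the windows a, ..., a + d that contain k. Exchanging
  the sums and writing k = a + j collects the terms by windows, and each window carries the
  barycentric weights of polynomial interpolation.\<close>

lemma sum_fh_weight:
  assumes "d \<le> m"
  shows "(\<Sum>k\<in>{0..m}. fh_weight m d k * f k)
    = (\<Sum>a\<le>m - d. \<Sum>j\<le>d. (-1) ^ a * ((-1) ^ (d + j) * real (d choose j)) * f (a + j))"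
proof -
  \<comment> \<open>The exponent may be negative; only its parity matters, and that is the parity of
    k + d.\<close>
  have sgn: "(-1 :: real) powi (int k - int d) = (-1) ^ (k + d)" for k
  proof (cases "d \<le> k")
    case True
    then have "int k - int d = int (k - d)" by simp
    then show ?thesis
      using True by (auto simp add: power_int_of_nat minus_one_power_iff)
  next
    case False
    then have "int k - int d = - int (d - k)" by simp
    then show ?thesis
      using False by (auto simp add: power_int_minus minus_one_power_iff)
  qed
  have "(\<Sum>k\<in>{0..m}. fh_weight m d k * f k)
    = (\<Sum>k\<in>{0..m}. \<Sum>a\<in>{k - d..min (m - d) k}. (-1) ^ (k + d) * real (d choose (k - a)) * f k)"
    by (simp add: fh_weight_def sgn sum_distrib_left sum_distrib_right mult.assoc)
  also have "\<dots> = (\<Sum>(k, a)\<in>Sigma {0..m} (\<lambda>k. {k - d..min (m - d) k}).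
      (-1) ^ (k + d) * real (d choose (k - a)) * f k)"
    by (rule sum.Sigma) auto
  also have "\<dots> = (\<Sum>(a, j)\<in>{..m - d} \<times> {..d}.
      (-1) ^ a * ((-1) ^ (d + j) * real (d choose j)) * f (a + j))"
    by (rule sum.reindex_bij_witness[of _ "\<lambda>(a, j). (a + j, a)" "\<lambda>(k, a). (a, k - a)"])
       (use assms in \<open>auto simp: power_add[symmetric] minus_one_power_iff\<close>)
  also have "\<dots> = (\<Sum>a\<le>m - d. \<Sum>j\<le>d. (-1) ^ a * ((-1) ^ (d + j) * real (d choose j)) * f (a + j))"
    by (rule sum.Sigma[symmetric]) auto
  finally show ?thesis .
qed

lemma fh_blend:
  assumes "d \<le> m" "\<And>j. j \<le> m \<Longrightarrow> u \<noteq> real j"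
  shows "(\<Sum>k\<in>{0..m}. fh_weight m d k * v k / (u - real k))
    = fact d * (\<Sum>a\<le>m - d. (-1) ^ a / nodal d (u - real a)
        * poly (interp_poly d (\<lambda>j. v (a + j))) (u - real a))"
proof -
  have "(\<Sum>k\<in>{0..m}. fh_weight m d k * v k / (u - real k))
    = (\<Sum>a\<le>m - d. (-1) ^ a * (\<Sum>j\<le>d. (-1) ^ (d + j) * real (d choose j) * v (a + j) / ((u - real a) - real j)))"
    using sum_fh_weight[OF assms(1), of "\<lambda>k. v k / (u - real k)"]
    by (simp add: sum_distrib_left mult_ac diff_diff_eq)
  also have "\<dots> = (\<Sum>a\<le>m - d. (-1) ^ a * (fact d / nodal d (u - real a)
        * poly (interp_poly d (\<lambda>j. v (a + j))) (u - real a)))"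
  proof (intro sum.cong refl arg_cong2[where f = "(*)"] barycentric_sum)
    fix a j assume "a \<in> {..m - d}" "j \<le> d"
    then have "a + j \<le> m" using assms(1) by auto
    then show "u - real a \<noteq> real j"
      using assms(2)[of "a + j"] by auto
  qed
  finally show ?thesis
    by (simp add: sum_distrib_left mult_ac)
qed

lemma fh_blend_weights:
  assumes "d \<le> m" "\<And>j. j \<le> m \<Longrightarrow> u \<noteq> real j"
  shows "(\<Sum>k\<in>{0..m}. fh_weight m d k / (u - real k))
    = fact d * (\<Sum>a\<le>m - d. (-1) ^ a / nodal d (u - real a))"
  using fh_blend[OF assms, of "\<lambda>_. 1"] by (simp add: poly_interp_poly sum_lagr)

text \<open>The common factor 1 / h cancels in the quotient, so later computations can use unit
  spacing.\<close>

lemma bary_affine: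
  assumes "h \<noteq> 0" "\<And>i. z i = c + x i * h"
  shows "bary I w z v (c + s * h) = bary I w x v s"
proof -
  have *: "c + s * h = z i \<longleftrightarrow> s = x i" for i
    using assms by auto
  have "(\<Sum>i\<in>I. f i / (c + s * h - z i)) = (\<Sum>i\<in>I. f i / (s - x i)) / h" for f
    unfolding sum_divide_distrib
    by (rule sum.cong) (use assms in \<open>auto simp: field_simps\<close>)
  then show ?thesis
    using assms(1) by (simp add: bary_def *)
qed

text \<open>With m = d there is a single window, so numerator and denominator share the factor
  \<open>fact d / nodal d s\<close> up to a constant and the quotient is the interpolation
  polynomial.\<close>

lemma fh_interp_full_degree:
  assumes "h \<noteq> 0" "\<And>j. z j = c + real j * h"
  shows "fh_interp d d z v x = poly (interp_poly d v) ((x - c) / h)"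
proof -
  define s where "s = (x - c) / h"
  have x: "x = c + s * h"
    using assms(1) by (simp add: s_def)
  have bary: "fh_interp d d z v x = bary {0..d} (fh_weight d d) real v s"
    unfolding fh_interp_def x by (rule bary_affine) (use assms in auto)
  show ?thesis
  proof (cases "\<exists>j\<le>d. s = real j")
    case True
    then obtain j where "j \<le> d" "s = real j" by auto
    then show ?thesis
      using bary by (simp add: bary_node poly_interp_poly_node flip: s_def)
  next
    case False
    then have "nodal d s \<noteq> 0"
      by (auto simp: nodal_eq_0_iff)
    then have "bary {0..d} (fh_weight d d) real v s = poly (interp_poly d v) s"
      using fh_blend[of d d s v] fh_blend_weights[of d d s] False
      by (auto simp: bary_def)
    then show ?thesis
      using bary by (simp add: s_def)
  qed
qed

section \<open>The extended values as values of interpolation polynomials\<close>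

lemma poly_taylor:
  fixes p :: "real poly"
  assumes "degree p \<le> d"
  shows "poly p x = poly p c + (\<Sum>k=1..d. (deriv ^^ k) (poly p) c * (x - c) ^ k / fact k)"
proof -
  have "deriv (poly q) = poly (pderiv q)" for q :: "real poly"
    by (rule ext) (rule DERIV_imp_deriv[OF poly_DERIV])
  then have deriv: "(deriv ^^ k) (poly p) = poly ((pderiv ^^ k) p)" for k
    by (induction k) simp_all
  \<comment> \<open>Moving c to the origin turns derivatives at c into coefficients.\<close>
  define q where "q = pcompose p [:c, 1:]"
  have "pderiv [:c, 1:] = 1"
    by (simp add: pderiv_pCons one_pCons)
  then have "(pderiv ^^ k) q = pcompose ((pderiv ^^ k) p) [:c, 1:]" for k
    by (induction k) (auto simp: q_def pderiv_pcompose)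
  then have coeff: "poly ((pderiv ^^ k) p) c = fact k * coeff q k" for k
    using coeff_higher_pderiv[of k q 0] by (simp add: pochhammer_fact poly_0_coeff_0[symmetric] poly_pcompose)
  have "poly p x = poly q (x - c)"
    by (simp add: q_def poly_pcompose)
  also have "\<dots> = (\<Sum>k\<le>d. coeff q k * (x - c) ^ k)"
    using assms unfolding poly_altdef
    by (intro sum.mono_neutral_left) (auto simp: q_def degree_pcompose coeff_eq_0)
  also have "\<dots> = coeff q 0 + (\<Sum>k=1..d. coeff q k * (x - c) ^ k)"
    unfolding atMost_atLeast0 by (subst sum.atLeast_Suc_atMost) auto
  finally show ?thesis
    using coeff[of 0] by (simp add: deriv coeff)
qed

text \<open>The interpolant is a polynomial of degree at most d, so its Taylor sum of order d is
  exact. The expansion point is node i: i = 0 serves the left end, i = d the right end.\<close>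

lemma fh_interp_taylor:
  assumes "h \<noteq> 0" "\<And>j. z j = c + real j * h" "i \<le> d"
  shows "v i + (\<Sum>k=1..d. (deriv ^^ k) (fh_interp d d z v) (z i) * (x - z i) ^ k / fact k)
    = poly (interp_poly d v) ((x - c) / h)"
proof -
  define p where "p = pcompose (interp_poly d v) [:- c / h, 1 / h:]"
  have p: "poly p x = poly (interp_poly d v) ((x - c) / h)" for x
    by (simp add: p_def poly_pcompose diff_divide_distrib)
  have "fh_interp d d z v = poly p"
    unfolding p fun_eq_iff using fh_interp_full_degree[OF assms(1,2)] by blast
  moreover have "degree p \<le> d"
    using degree_interp_poly[of d v] assms(1) by (simp add: p_def degree_pcompose)
  moreover have "poly p (z i) = v i"
    using assms by (simp add: p poly_interp_poly_node)
  ultimately show ?thesis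
    using poly_taylor[of p d x "z i"] p[of x] by simp
qed

lemma ext_val_eq:
  assumes "h \<noteq> 0" "d \<le> n"
  shows "ext_val x0 h n d d y i =
    (if i < 0 then poly (interp_poly d y) (of_int i)
     else if i \<le> int n then y (nat i)
     else poly (interp_poly d (\<lambda>j. y (n - d + j))) (of_int i - real (n - d)))"
proof -
  have left: "y 0 + (\<Sum>k=1..d. (deriv ^^ k) (fh_interp d d (\<lambda>j. node x0 h (int j)) y) (node x0 h 0)
            * (node x0 h i - node x0 h 0) ^ k / fact k) = poly (interp_poly d y) (of_int i)"
    using fh_interp_taylor[OF assms(1), of "\<lambda>j. node x0 h (int j)" x0 0 d y "node x0 h i"] assms(1)
    by (simp add: node_def)
  \<comment> \<open>The polynomial on the last d + 1 nodes has a local coordinate starting at node n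
    - d, in which the expansion point n has index d.\<close>
  have right: "y n + (\<Sum>k=1..d.
          (deriv ^^ k) (fh_interp d d (\<lambda>j. node x0 h (int (n - d + j))) (\<lambda>j. y (n - d + j)))
              (node x0 h (int n))
            * (node x0 h i - node x0 h (int n)) ^ k / fact k)
      = poly (interp_poly d (\<lambda>j. y (n - d + j))) (of_int i - real (n - d))"
    using fh_interp_taylor[OF assms(1), of "\<lambda>j. node x0 h (int (n - d + j))" "node x0 h (int (n - d))" d d
        "\<lambda>j. y (n - d + j)" "node x0 h i"] assms
    by (simp add: node_def algebra_simps add_divide_distrib diff_divide_distrib)
  show ?thesis
    unfolding ext_val_def using left right by (simp only: if_True if_False split: if_split)
qed

section \<open>Signs and sizes of the blending coefficients\<close>

text \<open>Peel off \<open>f 0\<close>: the negated tail satisfies the same hypotheses, so it lies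
  between 0 and \<open>- f 1\<close>, which is at most \<open>f 0\<close>. Stating the decay by a
  factor r avoids dividing by terms that may vanish.\<close>

lemma alternating_sum_bounds:
  fixes f :: "nat \<Rightarrow> real"
  assumes "0 \<le> f 0" "\<And>i. i < N \<Longrightarrow> \<exists>r. 0 \<le> r \<and> r \<le> 1 \<and> f (Suc i) = - r * f i"
  shows "0 \<le> (\<Sum>i\<le>N. f i)" and "(\<Sum>i\<le>N. f i) \<le> f 0"
proof -
  have "0 \<le> (\<Sum>i\<le>N. f i) \<and> (\<Sum>i\<le>N. f i) \<le> f 0"
    using assms
  proof (induction N arbitrary: f)
    case (Suc N)
    obtain r where r: "0 \<le> r" "r \<le> 1" "f 1 = - r * f 0"
      using Suc.prems(2)[of 0] by auto
    have "0 \<le> - f (Suc 0)"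
      using r Suc.prems(1) by simp
    moreover have "\<exists>r. 0 \<le> r \<and> r \<le> 1 \<and> - f (Suc (Suc i)) = - r * - f (Suc i)" if "i < N" for i
      using Suc.prems(2)[of "Suc i"] that by auto
    ultimately have "0 \<le> (\<Sum>i\<le>N. - f (Suc i)) \<and> (\<Sum>i\<le>N. - f (Suc i)) \<le> - f (Suc 0)"
      by (rule Suc.IH)
    moreover have "- f (Suc 0) \<le> f 0"
      using r Suc.prems(1) by (simp add: mult_left_le_one_le)
    moreover have "(\<Sum>i\<le>Suc N. f i) = f 0 - (\<Sum>i\<le>N. - f (Suc i))"
      by (subst sum.atMost_Suc_shift) (simp add: sum_negf)
    ultimately show ?case
      using Suc.prems(1) by linarith
  qed simp
  then show "0 \<le> (\<Sum>i\<le>N. f i)" and "(\<Sum>i\<le>N. f i) \<le> f 0"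
    by auto
qed

text \<open>The coefficient of window a without the common factor \<open>fact d\<close>. In the
  coordinate u the leftmost extended node is 0.\<close>

definition blend :: "nat \<Rightarrow> nat \<Rightarrow> real \<Rightarrow> real" where
  "blend d a u = (-1) ^ a / nodal d (u - real a)"

lemma nodal_nonzero:
  assumes "u \<notin> \<nat>"
  shows "nodal d (u - real a) \<noteq> 0"
proof
  assume "nodal d (u - real a) = 0"
  then obtain j where "u = real (a + j)"
    by (auto simp: nodal_eq_0_iff algebra_simps)
  then show False
    using assms of_nat_in_Nats by blast
qed

text \<open>The two linear factors govern all signs: for a < u < a + d + 1 both are positive and
  neighbouring coefficients agree in sign, while outside this range they have opposite signs and
  neighbours alternate.\<close>

lemma blend_step:
  assumes "u \<notin> \<nat>"
  shows "blend d (Suc a) u * (real a + real d + 1 - u) = blend d a u * (u - real a)"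
proof -
  have "(u - real (Suc a) - real d) * nodal d (u - real a) = (u - real a) * nodal d (u - real (Suc a))"
    using nodal_shift[of d "u - real (Suc a)"] by (simp add: mult.commute)
  then have "(u - real (Suc a) - real d) / nodal d (u - real (Suc a)) = (u - real a) / nodal d (u - real a)"
    using frac_eq_eq[OF nodal_nonzero[OF assms] nodal_nonzero[OF assms]] by blast
  moreover have "real a + real d + 1 - u = - (u - real (Suc a) - real d)"
    by simp
  moreover have "- 1 * p / q * - x = p * (x / q)" for p q x :: real
    by simp
  ultimately have "blend d (Suc a) u * (real a + real d + 1 - u)
      = (-1) ^ a * ((u - real a) / nodal d (u - real a))"
    by (simp only: blend_def power_Suc)
  then show ?thesis
    by (simp add: blend_def)
qed

lemma not_Nats_between:
  assumes "real M < u" "u < real M + 1"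
  shows "u \<notin> \<nat>"
proof
  assume "u \<in> \<nat>"
  then obtain j where "u = real j"
    by (auto elim: Nats_cases)
  then have "M < j" "real j < real (Suc M)"
    using assms by simp_all
  then show False
    by simp
qed

text \<open>The factors j = 0 and j = 1 give s (1 - s) up to sign; each further factor contributes j
  - s, which lies between 0 and j.\<close>

lemma nodal_unit_interval:
  assumes "0 < s" "s < 1" "1 \<le> d"
  shows "0 < (-1) ^ d * nodal d s" and "(-1) ^ d * nodal d s \<le> s * (1 - s) * fact d"
proof -
  have "0 < (-1) ^ d * nodal d s \<and> (-1) ^ d * nodal d s \<le> s * (1 - s) * fact d"
    using assms(3)
  proof (induction d rule: dec_induct)
    case base
    then show ?case
      using assms by (simp add: nodal_def algebra_simps)
  next
    case (step d)
    have eq: "(-1) ^ Suc d * nodal (Suc d) s = ((-1) ^ d * nodal d s) * (real (Suc d) - s)"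
      by (simp add: nodal_def algebra_simps)
    define v where "v = (-1) ^ d * nodal d s"
    have "v * (real (Suc d) - s) \<le> (s * (1 - s) * fact d) * real (Suc d)"
      using step.IH assms(1,2) unfolding v_def[symmetric] by (intro mult_mono) auto
    moreover have "0 < v * (real (Suc d) - s)"
      using step.IH assms(1,2) unfolding v_def[symmetric] by (intro mult_pos_pos) auto
    ultimately show ?case
      unfolding eq v_def[symmetric] by (simp add: algebra_simps)
  qed
  then show "0 < (-1) ^ d * nodal d s" and "(-1) ^ d * nodal d s \<le> s * (1 - s) * fact d"
    by auto
qed

text \<open>These are the windows that contain M or M + 1. The sign at a = M comes from
  \<open>nodal_unit_interval\<close>; \<open>blend_step\<close> carries it downwards while M <= a +
  d, and one step up to M + 1.\<close>

lemma blend_pos: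
  assumes "real M < u" "u < real M + 1" "1 \<le> d" "a \<le> Suc M" "M \<le> a + d"
  shows "0 < (-1) ^ (M + d) * blend d a u"
proof -
  have u: "u \<notin> \<nat>"
    by (rule not_Nats_between[OF assms(1,2)])
  have M: "0 < (-1) ^ (M + d) * blend d M u"
  proof -
    have "(-1) ^ (M + d) * blend d M u = 1 / ((-1) ^ d * nodal d (u - real M))"
      by (auto simp: blend_def minus_one_power_iff)
    then show ?thesis
      using nodal_unit_interval(1)[of "u - real M" d] assms by simp
  qed
  have low: "M \<le> a + d \<longrightarrow> 0 < (-1) ^ (M + d) * blend d a u" if "a \<le> M" for a
    using that
  proof (induction a rule: inc_induct)
    case base
    then show ?case using M by simp
  next
    case (step a)
    show ?case
    proof
      assume "M \<le> a + d"
      then have "real M \<le> real a + real d"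
        by linarith
      then have "0 < real a + real d + 1 - u"
        using assms(2) by linarith
      moreover have "0 < (-1) ^ (M + d) * blend d (Suc a) u"
        using step.IH \<open>M \<le> a + d\<close> by simp
      ultimately have "0 < ((-1) ^ (M + d) * blend d (Suc a) u) * (real a + real d + 1 - u)"
        by (metis mult_pos_pos)
      also have "\<dots> = ((-1) ^ (M + d) * blend d a u) * (u - real a)"
        using blend_step[OF u, of d a] by (simp add: mult.assoc)
      finally show "0 < (-1) ^ (M + d) * blend d a u"
        by (rule zero_less_mult_pos2) (use step.hyps assms(1) in simp)
    qed
  qed
  have "0 < ((-1) ^ (M + d) * blend d M u) * (u - real M)"
    using M assms(1) by (metis diff_gt_0_iff_gt mult_pos_pos)
  also have "\<dots> = ((-1) ^ (M + d) * blend d (Suc M) u) * (real M + real d + 1 - u)"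
    using blend_step[OF u, of d M] by (simp add: mult.assoc)
  finally have "0 < (-1) ^ (M + d) * blend d (Suc M) u"
    by (rule zero_less_mult_pos2) (use assms in simp)
  then show ?thesis
    using low assms le_Suc_eq by blast
qed

text \<open>To the right of u the ratio of neighbours is -(a - u) / (a + d + 1 - u), between -1 and
  0. The multiplier c may be a sign or a polynomial value of unknown sign; only the first product
  has to be known as nonnegative.\<close>

lemma blend_tail:
  assumes "u \<notin> \<nat>" "u < real b" "b \<le> A" "0 \<le> c * blend d b u"
  shows "0 \<le> c * (\<Sum>a=b..A. blend d a u)" and "c * (\<Sum>a=b..A. blend d a u) \<le> c * blend d b u"
proof -
  define f where "f i = c * blend d (b + i) u" for i
  have "\<exists>r. 0 \<le> r \<and> r \<le> 1 \<and> f (Suc i) = - r * f i" for i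
  proof (intro exI conjI)
    define r where "r = (real (b + i) - u) / (real (b + i) + real d + 1 - u)"
    show "0 \<le> r" "r \<le> 1"
      using assms by (auto simp: r_def)
    have "real (b + i) + real d + 1 - u \<noteq> 0"
      using assms by simp
    then have "blend d (Suc (b + i)) u = blend d (b + i) u * (u - real (b + i)) / (real (b + i) + real d + 1 - u)"
      using blend_step[OF assms(1), of d "b + i"] nonzero_eq_divide_eq by blast
    also have "\<dots> = - r * blend d (b + i) u"
      unfolding r_def minus_divide_left minus_diff_eq by simp
    finally show "f (Suc i) = - r * f i"
      by (simp add: f_def)
  qed
  moreover have "0 \<le> f 0"
    using assms by (simp add: f_def)
  moreover have "c * (\<Sum>a=b..A. blend d a u) = (\<Sum>i\<le>A - b. f i)"
    unfolding sum_distrib_left f_def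
    by (rule sum.reindex_bij_witness[of _ "\<lambda>i. b + i" "\<lambda>i. i - b"]) (use assms in auto)
  ultimately show "0 \<le> c * (\<Sum>a=b..A. blend d a u)" and "c * (\<Sum>a=b..A. blend d a u) \<le> c * blend d b u"
    using alternating_sum_bounds[of f "A - b"] by (auto simp: f_def)
qed

text \<open>Mirror image of \<open>blend_tail\<close>: windows entirely to the left of u, summed
  downwards from b.\<close>

lemma blend_head:
  assumes "u \<notin> \<nat>" "real (b + d) < u" "0 \<le> c * blend d b u"
  shows "0 \<le> c * (\<Sum>a\<le>b. blend d a u)"
proof -
  define f where "f i = c * blend d (b - i) u" for i
  have "\<exists>r. 0 \<le> r \<and> r \<le> 1 \<and> f (Suc i) = - r * f i" if "i < b" for i
  proof (intro exI conjI)
    define k where "k = b - Suc i"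
    have k: "b - i = Suc k" "Suc k \<le> b"
      using that by (auto simp: k_def)
    define r where "r = (u - (real k + real d + 1)) / (u - real k)"
    have pos: "0 < u - real k" "real k + real d + 1 \<le> u"
      using k assms(2) by auto
    show "0 \<le> r" "r \<le> 1"
      using pos by (auto simp: r_def)
    have "f i = c * blend d (Suc k) u" "f (Suc i) = c * blend d k u"
      using k by (auto simp: f_def k_def)
    moreover have "blend d k u = blend d (Suc k) u * (real k + real d + 1 - u) / (u - real k)"
      using blend_step[OF assms(1), of d k] pos(1) by (simp add: nonzero_eq_divide_eq)
    then have "blend d k u = - r * blend d (Suc k) u"
      unfolding r_def minus_divide_left minus_diff_eq by simp
    ultimately show "f (Suc i) = - r * f i"
      by simp
  qed
  moreover have "0 \<le> f 0"
    using assms by (simp add: f_def)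
  moreover have "c * (\<Sum>a\<le>b. blend d a u) = (\<Sum>i\<le>b. f i)"
    unfolding sum_distrib_left f_def
    by (rule sum.reindex_bij_witness[of _ "\<lambda>i. b - i" "\<lambda>i. b - i"]) auto
  ultimately show ?thesis
    using alternating_sum_bounds(1)[of f b] by auto
qed

text \<open>Cut the windows after M - d and after M. Both outer blocks alternate, starting from a
  coefficient of the right sign next to the cut; the middle terms all have that sign, and a = M is
  one of them.\<close>

lemma blend_sum_ge:
  assumes "real M < u" "u < real M + 1" "1 \<le> d" "d \<le> M" "M < A"
  shows "(-1) ^ (M + d) * blend d M u \<le> (-1) ^ (M + d) * (\<Sum>a\<le>A. blend d a u)"
proof -
  define c :: real where "c = (-1) ^ (M + d)"
  have u: "u \<notin> \<nat>"
    by (rule not_Nats_between[OF assms(1,2)])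
  have pos: "0 < c * blend d a u" if "a \<le> Suc M" "M \<le> a + d" for a
    using blend_pos[OF assms(1-3) that] by (simp add: c_def)
  have cut: "(\<Sum>a\<le>q. blend d a u) = (\<Sum>a\<le>p. blend d a u) + (\<Sum>a=Suc p..q. blend d a u)" if "p \<le> q" for p q
  proof -
    have "{..q} = {..p} \<union> {Suc p..q}"
      using that by auto
    then show ?thesis
      by (simp add: sum.union_disjoint disjoint_iff)
  qed
  have split: "(\<Sum>a\<le>A. blend d a u)
      = (\<Sum>a\<le>M - d. blend d a u) + (\<Sum>a=Suc (M - d)..M. blend d a u) + (\<Sum>a=Suc M..A. blend d a u)"
    using assms by (simp add: cut[of M A] cut[of "M - d" M])
  have "0 \<le> c * (\<Sum>a\<le>M - d. blend d a u)"
    using less_imp_le[OF pos[of "M - d"]] assms u by (intro blend_head) auto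
  moreover have "0 \<le> c * (\<Sum>a=Suc M..A. blend d a u)"
    using less_imp_le[OF pos[of "Suc M"]] assms u by (intro blend_tail) auto
  moreover have "c * blend d M u \<le> (\<Sum>a=Suc (M - d)..M. c * blend d a u)"
    using assms pos by (intro member_le_sum) (auto intro!: less_imp_le[OF pos])
  ultimately show ?thesis
    unfolding split c_def by (simp add: distrib_left sum_distrib_left)
qed

text \<open>The ratio of coefficient d - i - 1 to coefficient d - i is (d - i - t) / (t + i + 1),
  which decreases in t. At t = 1 it is the ratio of \<open>d choose (i + 2)\<close> to
  \<open>d choose (i + 1)\<close>. Hence the coefficients dominate a multiple of the binomials with
  positive lower index, whose sum is 2^d - 1.\<close>

lemma blend_main_sum_ge:
  assumes "0 < t" "t < 1" "1 \<le> d"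
  shows "(2 ^ d - 1) * blend d d (t + real d) \<le> real d * (\<Sum>a\<le>d. blend d a (t + real d))"
proof -
  let ?b = "\<lambda>a. blend d a (t + real d)"
  have u: "t + real d \<notin> \<nat>"
    using assms by (intro not_Nats_between[of d]) auto
  have pos: "0 < ?b a" if "a \<le> Suc d" for a
    using blend_pos[of d "t + real d" d a] assms that by simp
  have lower: "?b d * real (d choose Suc i) \<le> real d * ?b (d - i)" if "i < d" for i
    using that
  proof (induction i)
    case (Suc i)
    define C where "C = real (d choose Suc i)"
    define C' where "C' = real (d choose Suc (Suc i))"
    have "Suc d * (d choose Suc i) = (Suc d choose Suc (Suc i)) * Suc (Suc i)"
      by (rule Suc_times_binomial_eq)
    then have "real (Suc d) * C = (C + C') * real (Suc (Suc i))"
      unfolding C_def C'_def by (metis binomial_Suc_Suc of_nat_add of_nat_mult)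
    then have C': "C' * (real i + 2) = C * (real d - real i - 1)"
      by (simp add: algebra_simps)
    have step: "?b (d - Suc i) * (t + real i + 1) = ?b (d - i) * (real d - real i - t)"
      using blend_step[OF u, of d "d - Suc i"] Suc.prems
      by (simp add: Suc_diff_Suc of_nat_diff algebra_simps)
    have "real (Suc i) \<le> real d - 1"
      using Suc.prems by linarith
    have "(?b d * C') * (t + real i + 1) \<le> (?b d * C') * (real i + 2)"
      using assms pos[of d] by (intro mult_left_mono) (auto simp: C'_def)
    also have "\<dots> = (?b d * C) * (real d - real i - 1)"
      using C' by simp
    also have "\<dots> \<le> (real d * ?b (d - i)) * (real d - real i - 1)"
      using Suc \<open>real (Suc i) \<le> real d - 1\<close> by (intro mult_right_mono) (auto simp: C_def)
    also have "\<dots> \<le> (real d * ?b (d - i)) * (real d - real i - t)"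
      using less_imp_le[OF pos[of "d - i"]] assms by (intro mult_left_mono mult_nonneg_nonneg) auto
    also have "\<dots> = (real d * ?b (d - Suc i)) * (t + real i + 1)"
      using step by simp
    finally show ?case
      using assms unfolding C'_def by (simp add: mult_le_cancel_right)
  qed simp
  have "2 ^ d = (\<Sum>i\<le>d. real (d choose i))"
    using choose_row_sum[of d] by (metis of_nat_numeral of_nat_power of_nat_sum)
  also have "{..d} = insert 0 (Suc ` {..<d})"
    using image_Suc_lessThan by auto
  also have "(\<Sum>i\<in>insert 0 (Suc ` {..<d}). real (d choose i)) = 1 + (\<Sum>i<d. real (d choose Suc i))"
    by (subst sum.insert) (auto simp: sum.reindex)
  finally have "(2 ^ d - 1) * ?b d = (\<Sum>i<d. ?b d * real (d choose Suc i))"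
    by (simp add: sum_distrib_left mult.commute)
  also have "\<dots> \<le> (\<Sum>i<d. real d * ?b (d - i))"
    using lower by (intro sum_mono) auto
  also have "\<dots> = (\<Sum>a=1..d. real d * ?b a)"
    by (rule sum.reindex_bij_witness[of _ "\<lambda>i. d - i" "\<lambda>i. d - i"]) auto
  also have "\<dots> \<le> (\<Sum>a\<le>d. real d * ?b a)"
    using pos by (intro sum_mono2) (auto intro!: mult_nonneg_nonneg less_imp_le[OF pos])
  finally show ?thesis
    by (simp add: sum_distrib_left)
qed

section \<open>The Lebesgue function of polynomial interpolation\<close>

definition lebfun :: "nat \<Rightarrow> real \<Rightarrow> real" where
  "lebfun d s = (\<Sum>k\<le>d. \<bar>poly (lagr d k) s\<bar>)"

lemma lebfun_eq:
  assumes "\<And>j. j \<le> d \<Longrightarrow> s \<noteq> real j"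
  shows "lebfun d s = \<bar>nodal d s\<bar> / fact d * (\<Sum>k\<le>d. real (d choose k) / \<bar>s - real k\<bar>)"
  unfolding lebfun_def sum_distrib_left
  by (rule sum.cong) (use assms in \<open>auto simp: poly_lagr abs_mult abs_divide power_abs\<close>)

lemma lebfun_ge_1: "1 \<le> lebfun d s"
  using sum_abs[of "\<lambda>k. poly (lagr d k) s" "{..d}"] by (simp add: sum_lagr lebfun_def)

lemma lebfun_node:
  assumes "j \<le> d"
  shows "lebfun d (real j) = 1"
proof -
  have "lebfun d (real j) = (\<Sum>k\<le>d. if j = k then 1 else 0)"
    unfolding lebfun_def by (rule sum.cong) (use assms in \<open>auto simp: poly_lagr_node\<close>)
  then show ?thesis
    using assms by simp
qed

lemma lebfun_reflect:
  assumes "\<And>j. j \<le> d \<Longrightarrow> s \<noteq> real j"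
  shows "lebfun d (real d - s) = lebfun d s"
proof -
  have "real d - s \<noteq> real j" if "j \<le> d" for j
    using assms[of "d - j"] that by (auto simp: of_nat_diff)
  moreover have "(\<Sum>k\<le>d. real (d choose k) / \<bar>real d - s - real k\<bar>)
      = (\<Sum>k\<le>d. real (d choose k) / \<bar>s - real k\<bar>)"
    by (rule sum.reindex_bij_witness[of _ "\<lambda>k. d - k" "\<lambda>k. d - k"])
       (auto simp: binomial_symmetric[symmetric] of_nat_diff abs_minus_commute)
  ultimately show ?thesis
    using assms by (simp add: lebfun_eq nodal_reflect abs_mult power_abs)
qed

text \<open>The reflection j -> d + 1 - j sends j <= k + 1 to j >= d - k, and d - k >= k +
  2.\<close>

lemma lower_binomial_sum_le:
  assumes "2 * k + 2 \<le> d"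
  shows "(\<Sum>j\<le>k + 1. real (Suc d choose j)) \<le> (\<Sum>j=k+2..Suc d. real (Suc d choose j))"
proof -
  have "(\<Sum>j\<le>k + 1. real (Suc d choose j)) = (\<Sum>j=d - k..Suc d. real (Suc d choose j))"
    by (rule sum.reindex_bij_witness[of _ "\<lambda>j. Suc d - j" "\<lambda>j. Suc d - j"])
       (use assms in \<open>auto simp: binomial_symmetric[symmetric]\<close>)
  also have "\<dots> \<le> (\<Sum>j=k+2..Suc d. real (Suc d choose j))"
    using assms by (intro sum_mono2) auto
  finally show ?thesis .
qed

text \<open>Multiplied by suitable positive factors, the two values of the Lebesgue function differ by a
  signed sum of binomial coefficients.\<close>

lemma lebfun_step:
  assumes "real k < s" "s < real k + 1" "2 * k + 2 \<le> d"
  shows "lebfun d (s + 1) \<le> lebfun d s"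
proof -
  define A where "A s = (\<Sum>j\<le>d. real (d choose j) / \<bar>s - real j\<bar>)" for s
  have ne: "s \<noteq> real j" "s + 1 \<noteq> real j" for j
    using not_Nats_between[OF assms(1,2)] not_Nats_between[of "Suc k" "s + 1"] assms(1,2)
    by (auto intro: of_nat_in_Nats)
  \<comment> \<open>\<open>D j\<close> is the binomial with lower index j - 1, and 0 at j = 0. The
    index shift gives both sums the denominators |s + 1 - j|.\<close>
  define D where "D j = (case j of 0 \<Rightarrow> 0 | Suc i \<Rightarrow> real (d choose i))" for j
  \<comment> \<open>The combined numerator contains s + 1 - j, so dividing by its modulus leaves a
    sign, positive exactly for j <= k + 1.\<close>
  have key: "real (d choose j) * (s + 1) - D j * (real d - s) = (s + 1 - real j) * real (Suc d choose j)" for j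
  proof (cases j)
    case 0
    then show ?thesis by (simp add: D_def)
  next
    case (Suc i)
    have "Suc d * (d choose i) = (Suc d choose Suc i) * Suc i"
      by (rule Suc_times_binomial_eq)
    then have "real (Suc d) * real (d choose i) = (real (d choose i) + real (d choose Suc i)) * real (Suc i)"
      by (metis binomial_Suc_Suc of_nat_add of_nat_mult)
    then show ?thesis
      by (simp add: Suc D_def algebra_simps)
  qed
  \<comment> \<open>The added term j = d + 1 vanishes because \<open>d choose Suc d\<close> is
    0.\<close>
  have "(s + 1) * A (s + 1) = (\<Sum>j\<le>Suc d. real (d choose j) * (s + 1) / \<bar>s + 1 - real j\<bar>)"
    by (simp add: A_def sum_distrib_left mult.commute)
  moreover have "(real d - s) * A s = (\<Sum>j\<le>Suc d. D j * (real d - s) / \<bar>s + 1 - real j\<bar>)"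
    by (subst sum.atMost_Suc_shift) (simp add: A_def D_def sum_distrib_left mult.commute)
  ultimately have "(s + 1) * A (s + 1) - (real d - s) * A s
      = (\<Sum>j\<le>Suc d. (real (d choose j) * (s + 1) - D j * (real d - s)) / \<bar>s + 1 - real j\<bar>)"
    by (simp only: sum_subtractf diff_divide_distrib)
  also have "\<dots> = (\<Sum>j\<le>Suc d. sgn (s + 1 - real j) * real (Suc d choose j))"
    unfolding key real_sgn_eq by simp
  also have "{..Suc d} = {..k + 1} \<union> {k + 2..Suc d}"
    using assms(3) by auto
  also have "(\<Sum>j\<in>{..k + 1} \<union> {k + 2..Suc d}. sgn (s + 1 - real j) * real (Suc d choose j))
      = (\<Sum>j\<le>k + 1. real (Suc d choose j)) + (\<Sum>j=k+2..Suc d. - real (Suc d choose j))"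
    using assms by (subst sum.union_disjoint) (auto intro!: arg_cong2[where f = "(+)"] sum.cong)
  also have "\<dots> \<le> 0"
    using lower_binomial_sum_le[OF assms(3)] by (simp add: sum_negf)
  finally have A: "(s + 1) * A (s + 1) \<le> (real d - s) * A s"
    by simp
  have sd: "0 < real d - s"
    using assms by linarith
  have s1: "0 < s + 1"
    using assms by linarith
  \<comment> \<open>\<open>nodal_shift\<close> supplies exactly the weights s + 1 and d - s of
    \<open>A (s + 1)\<close> and \<open>A s\<close>.\<close>
  have "\<bar>nodal d (s + 1)\<bar> * (real d - s) = \<bar>nodal d s\<bar> * (s + 1)"
    using arg_cong[OF nodal_shift[of d s], of abs] sd s1 by (simp add: abs_mult)
  then have "\<bar>nodal d (s + 1)\<bar> * (real d - s) * (A (s + 1) / fact d) = \<bar>nodal d s\<bar> * (s + 1) * (A (s + 1) / fact d)"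
    by simp
  then have "lebfun d (s + 1) * (real d - s) = \<bar>nodal d s\<bar> / fact d * ((s + 1) * A (s + 1))"
    using ne by (simp add: lebfun_eq A_def[symmetric] mult_ac)
  also have "\<dots> \<le> \<bar>nodal d s\<bar> / fact d * ((real d - s) * A s)"
    by (intro mult_left_mono A) auto
  also have "\<dots> = lebfun d s * (real d - s)"
    using ne by (simp add: lebfun_eq A_def)
  finally show ?thesis
    using sd by simp
qed

lemma lebfun_first_interval:
  assumes "real k < s" "s < real k + 1" "2 * k \<le> d"
  shows "lebfun d s \<le> lebfun d (s - real k)"
  using assms
proof (induction k arbitrary: s)
  case (Suc k)
  have "lebfun d ((s - 1) + 1) \<le> lebfun d (s - 1)"
    using Suc.prems by (intro lebfun_step[of k]) auto
  also have "\<dots> \<le> lebfun d (s - 1 - real k)"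
    using Suc.prems by (intro Suc.IH) auto
  finally show ?case
    by (simp add: algebra_simps)
qed simp

text \<open>In the left half, unit steps lead to the first interval; in the right half, t is
  reflected first. At a node the value is 1, a lower bound everywhere, so any s in (0, 1)
  serves.\<close>

lemma lebfun_bounded_by_first_interval:
  assumes "0 \<le> t" "t \<le> real d"
  obtains s where "0 < s" "s < 1" "lebfun d t \<le> lebfun d s"
proof (cases "\<exists>j\<le>d. t = real j")
  case True
  then show ?thesis
    using lebfun_ge_1[of d "1 / 2"] by (intro that[of "1 / 2"]) (auto simp: lebfun_node)
next
  case False
  define k where "k = nat \<lfloor>t\<rfloor>"
  have k: "real k \<le> t" "t < real k + 1"
    using assms by (auto simp: k_def)
  then have "k \<le> d"
    using assms by linarith
  then have "real k \<noteq> t"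
    using False by auto
  then have k1: "real k < t"
    using k by simp
  then have "k < d"
    using assms by linarith
  show ?thesis
  proof (cases "2 * k \<le> d")
    case True
    then show ?thesis
      using k k1 lebfun_first_interval[of k t d] by (intro that[of "t - real k"]) auto
  next
    case False': False
    \<comment> \<open>The index of the unit interval that contains d - t.\<close>
    define l where "l = d - Suc k"
    have l: "real l = real d - real k - 1"
      using \<open>k < d\<close> by (simp add: l_def)
    have "lebfun d (real d - t) \<le> lebfun d (real d - t - real l)"
      using k k1 l False' by (intro lebfun_first_interval) (auto simp: l_def)
    moreover have "lebfun d (real d - t) = lebfun d t"
      using False by (intro lebfun_reflect) auto
    ultimately show ?thesis
      using k k1 l by (intro that[of "real d - t - real l"]) auto
  qed
qed

lemma abs_interp_poly_le:
  assumes "\<And>k. k \<le> d \<Longrightarrow> \<bar>y k\<bar> \<le> B"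
  shows "\<bar>poly (interp_poly d y) s\<bar> \<le> B * lebfun d s"
proof -
  have "\<bar>poly (interp_poly d y) s\<bar> \<le> (\<Sum>k\<le>d. \<bar>y k * poly (lagr d k) s\<bar>)"
    unfolding poly_interp_poly by (rule sum_abs)
  also have "\<dots> \<le> (\<Sum>k\<le>d. B * \<bar>poly (lagr d k) s\<bar>)"
    unfolding abs_mult using assms by (intro sum_mono mult_right_mono) auto
  finally show ?thesis
    by (simp add: lebfun_def sum_distrib_left)
qed

lemma abs_le_max_norm: "i \<le> n \<Longrightarrow> \<bar>y i\<bar> \<le> max_norm n y"
  unfolding max_norm_def by (intro Max_ge) auto

section \<open>The extended interpolant\<close>

lemma ext_fh_interp_eq_bary:
  assumes "h \<noteq> 0"
  shows "ext_fh_interp x0 h n d nt dt y (x0 + t * h)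
    = bary {- int d..int n + int d} (ext_weight n d) of_int (ext_val x0 h n nt dt y) t"
  unfolding ext_fh_interp_def by (rule bary_affine) (use assms in \<open>auto simp: node_def\<close>)

lemma ext_fh_interp_node:
  assumes "h \<noteq> 0" "i \<le> n"
  shows "ext_fh_interp x0 h n d nt dt y (x0 + real i * h) = y i"
proof -
  have "bary {- int d..int n + int d} (ext_weight n d) of_int (ext_val x0 h n nt dt y) (of_int (int i))
      = ext_val x0 h n nt dt y (int i)"
    using assms(2) by (intro bary_node) (auto simp: inj_on_def)
  then show ?thesis
    using assms by (simp add: ext_fh_interp_eq_bary ext_val_def)
qed

lemma ext_fh_interp_quotient:
  fixes t :: real
  assumes "h \<noteq> 0" "t + real d \<notin> \<nat>"
  defines "u \<equiv> t + real d"
  shows "ext_fh_interp x0 h n d nt dt y (x0 + t * h)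
    = (\<Sum>k\<in>{0..n + 2 * d}. fh_weight (n + 2 * d) d k * ext_val x0 h n nt dt y (int k - int d) / (u - real k))
      / (\<Sum>k\<in>{0..n + 2 * d}. fh_weight (n + 2 * d) d k / (u - real k))"
proof -
  have "t \<noteq> of_int i" if "i \<in> {- int d..int n + int d}" for i
  proof
    assume "t = of_int i"
    then have "t + real d = real (nat (i + int d))"
      using that by simp
    then show False
      using assms(2) of_nat_in_Nats by metis
  qed
  moreover have sums: "(\<Sum>i\<in>{- int d..int n + int d}. ext_weight n d i * f i / (t - of_int i))
      = (\<Sum>k\<in>{0..n + 2 * d}. fh_weight (n + 2 * d) d k * f (int k - int d) / (u - real k))" for f
    by (rule sum.reindex_bij_witness[of _ "\<lambda>k. int k - int d" "\<lambda>i. nat (i + int d)"])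
       (auto simp: ext_weight_def u_def)
  ultimately show ?thesis
    using sums[of "\<lambda>_. 1"] assms(1) by (simp add: ext_fh_interp_eq_bary bary_def)
qed

lemma ext_fh_interp_blend:
  fixes t :: real
  assumes "h \<noteq> 0" "t + real d \<notin> \<nat>"
  defines "u \<equiv> t + real d"
  shows "ext_fh_interp x0 h n d nt dt y (x0 + t * h)
    = (\<Sum>a\<le>n + d. blend d a u
        * poly (interp_poly d (\<lambda>j. ext_val x0 h n nt dt y (int (a + j) - int d))) (u - real a))
      / (\<Sum>a\<le>n + d. blend d a u)"
proof -
  have "u \<noteq> real j" for j
    using assms(2) of_nat_in_Nats unfolding u_def by metis
  then show ?thesis
    using fh_blend[of d "n + 2 * d" u "\<lambda>k. ext_val x0 h n nt dt y (int k - int d)"]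
      fh_blend_weights[of d "n + 2 * d" u]
    by (simp add: ext_fh_interp_quotient[OF assms(1,2)] blend_def add.commute flip: u_def)
qed

section \<open>Boundedness of the interpolants for normalised data\<close>

lemma ext_val_bounded:
  assumes "h \<noteq> 0" "d \<le> n"
  obtains C where "0 \<le> C"
    "\<And>y i. max_norm n y = 1 \<Longrightarrow> i \<in> {- int d..int n + int d} \<Longrightarrow> \<bar>ext_val x0 h n d d y i\<bar> \<le> C"
proof -
  \<comment> \<open>\<open>B i\<close> covers the three cases of the extended value at once; its sum
    over the finitely many indices bounds every case independently of y and i.\<close>
  define B where "B i = 1 + lebfun d (of_int i) + lebfun d (of_int i - real (n - d))" for i :: int
  have leb: "0 \<le> lebfun d s" for s
    using lebfun_ge_1[of d s] by linarith
  have "\<bar>ext_val x0 h n d d y i\<bar> \<le> B i" if "max_norm n y = 1" for y i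
  proof -
    have y: "\<bar>y k\<bar> \<le> 1" if "k \<le> n" for k
      using abs_le_max_norm[OF that, of y] \<open>max_norm n y = 1\<close> by simp
    then have "\<bar>poly (interp_poly d y) (of_int i)\<bar> \<le> lebfun d (of_int i)"
      using abs_interp_poly_le[of d y 1] assms by simp
    moreover have "\<bar>poly (interp_poly d (\<lambda>j. y (n - d + j))) (of_int i - real (n - d))\<bar>
        \<le> lebfun d (of_int i - real (n - d))"
      using abs_interp_poly_le[of d "\<lambda>j. y (n - d + j)" 1] assms y by simp
    ultimately show ?thesis
      using leb[of "of_int i"] leb[of "of_int i - real (n - d)"] y[of "nat i"]
      by (auto simp: ext_val_eq[OF assms] B_def nat_le_iff)
  qed
  moreover have "0 \<le> B i" for i
    using leb[of "of_int i"] leb[of "of_int i - real (n - d)"] by (simp add: B_def)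
  then have "B i \<le> sum B {- int d..int n + int d}" if "i \<in> {- int d..int n + int d}" for i
    using that by (intro member_le_sum) auto
  ultimately show ?thesis
    using \<open>\<And>i. 0 \<le> B i\<close>
    by (intro that[of "sum B {- int d..int n + int d}"] sum_nonneg) (blast intro: order_trans)+
qed

lemma real_nat_or_between:
  assumes "0 \<le> (u :: real)"
  obtains k where "u = real k" | k where "real k < u" "u < real k + 1"
proof -
  have "real (nat \<lfloor>u\<rfloor>) \<le> u" "u < real (nat \<lfloor>u\<rfloor>) + 1"
    using assms by auto
  then show ?thesis
    using that(1)[of "nat \<lfloor>u\<rfloor>"] that(2)[of "nat \<lfloor>u\<rfloor>"] by linarith
qed

text \<open>A real \<open>SUP\<close> is informative only for bounded families. Near a node
  numerator and denominator both blow up; both are compared with 1 / (s (1 - s)), where s is the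
  offset in the unit interval. In the bound \<open>1 + W * C\<close> the 1 covers the nodes.\<close>

lemma ext_fh_interp_bounded:
  assumes "h > 0" "1 \<le> d" "d \<le> n"
  obtains K where "\<And>t y. t \<in> {node x0 h 0..node x0 h (int n)} \<Longrightarrow> max_norm n y = 1
    \<Longrightarrow> \<bar>ext_fh_interp x0 h n d d d y t\<bar> \<le> K"
proof -
  obtain C where C: "0 \<le> C"
    "\<And>y i. max_norm n y = 1 \<Longrightarrow> i \<in> {- int d..int n + int d} \<Longrightarrow> \<bar>ext_val x0 h n d d y i\<bar> \<le> C"
    using ext_val_bounded[of h d n] assms by (metis less_irrefl)
  define m where "m = n + 2 * d"
  define W where "W = (\<Sum>k\<in>{0..m}. \<bar>fh_weight m d k\<bar>)"
  have W: "0 \<le> W * C"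
    using C(1) by (simp add: W_def sum_nonneg)
  have "\<bar>ext_fh_interp x0 h n d d d y x\<bar> \<le> 1 + W * C"
    if x: "x \<in> {node x0 h 0..node x0 h (int n)}" and y: "max_norm n y = 1" for x y
  proof -
    define t where "t = (x - x0) / h"
    have xt: "x = x0 + t * h" and t: "0 \<le> t" "t \<le> real n"
      using x assms(1) by (auto simp: t_def node_def field_simps)
    show ?thesis
      using t(1)
    proof (cases rule: real_nat_or_between)
      case (1 k)
      then have "\<bar>ext_fh_interp x0 h n d d d y x\<bar> = \<bar>y k\<bar>" "k \<le> n"
        using t assms by (simp_all add: xt ext_fh_interp_node)
      then show ?thesis
        using abs_le_max_norm[of k n y] y W by simp
    next
      case (2 k)
      define u where "u = t + real d"
      define M where "M = k + d"
      define s where "s = u - real M"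
      have s: "0 < s" "s < 1"
        using 2 by (auto simp: s_def u_def M_def)
      have Mu: "real M < u" "u < real M + 1"
        using s by (auto simp: s_def)
      have u: "u \<notin> \<nat>"
        by (rule not_Nats_between[OF Mu])
      then have ne: "u \<noteq> real j" for j
        using of_nat_in_Nats by metis
      have "k < n"
        using 2 t by linarith
      define D where "D = (\<Sum>k\<in>{0..m}. fh_weight m d k / (u - real k))"
      define N where "N = (\<Sum>k\<in>{0..m}. fh_weight m d k * ext_val x0 h n d d y (int k - int d) / (u - real k))"
      have r: "ext_fh_interp x0 h n d d d y x = N / D"
        using ext_fh_interp_quotient[of h t d] u assms(1) by (simp add: xt N_def D_def u_def m_def)
      have ss: "0 < s * (1 - s)"
        using s by simp
      have nod: "0 < (-1) ^ d * nodal d s" "(-1) ^ d * nodal d s \<le> s * (1 - s) * fact d"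
        using nodal_unit_interval s assms by auto
      have "1 / (s * (1 - s)) \<le> fact d / ((-1) ^ d * nodal d s)"
        using nod ss by (simp add: frac_le_eq divide_simps mult.commute)
      also have "\<dots> = fact d * ((-1) ^ (M + d) * blend d M u)"
        by (auto simp: blend_def s_def minus_one_power_iff)
      also have "\<dots> \<le> fact d * ((-1) ^ (M + d) * (\<Sum>a\<le>n + d. blend d a u))"
        using assms \<open>k < n\<close> by (intro mult_left_mono blend_sum_ge[OF Mu]) (auto simp: M_def)
      also have "\<dots> = (-1) ^ (M + d) * D"
        using fh_blend_weights[of d m u] ne by (simp add: D_def m_def blend_def add.commute)
      also have "\<dots> \<le> \<bar>D\<bar>"
        by (cases "even (M + d)") auto
      finally have D: "1 / (s * (1 - s)) \<le> \<bar>D\<bar>" .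
      have "\<bar>N\<bar> \<le> (\<Sum>k\<in>{0..m}. \<bar>fh_weight m d k * ext_val x0 h n d d y (int k - int d) / (u - real k)\<bar>)"
        unfolding N_def by (rule sum_abs)
      also have "\<dots> \<le> (\<Sum>k\<in>{0..m}. \<bar>fh_weight m d k\<bar> * C * (1 / (s * (1 - s))))"
      proof (rule sum_mono)
        fix j assume j: "j \<in> {0..m}"
        \<comment> \<open>Every node is at distance at least s or at least 1 - s, and s (1 - s) is
          below both.\<close>
        have "s * (1 - s) \<le> \<bar>u - real j\<bar>"
        proof (cases "j \<le> M")
          case True
          then have "s \<le> u - real j"
            by (simp add: s_def)
          moreover have "s * (1 - s) \<le> s"
            using s by (simp add: mult_left_le)
          ultimately show ?thesis
            by linarith
        next
          case False
          then have "real M + 1 \<le> real j"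
            by linarith
          then have "1 - s \<le> real j - u"
            by (simp add: s_def)
          moreover have "s * (1 - s) \<le> 1 - s"
            using s by (simp add: mult_left_le_one_le)
          ultimately show ?thesis
            by linarith
        qed
        then have "1 / \<bar>u - real j\<bar> \<le> 1 / (s * (1 - s))"
          using ss by (intro divide_left_mono) (auto intro: mult_pos_pos)
        moreover have "\<bar>ext_val x0 h n d d y (int j - int d)\<bar> \<le> C"
          using j by (intro C(2) y) (auto simp: m_def)
        ultimately have "\<bar>fh_weight m d j\<bar> * \<bar>ext_val x0 h n d d y (int j - int d)\<bar> * (1 / \<bar>u - real j\<bar>)
            \<le> \<bar>fh_weight m d j\<bar> * C * (1 / (s * (1 - s)))"
          using C(1) by (intro mult_mono) auto
        then show "\<bar>fh_weight m d j * ext_val x0 h n d d y (int j - int d) / (u - real j)\<bar>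
            \<le> \<bar>fh_weight m d j\<bar> * C * (1 / (s * (1 - s)))"
          by (simp add: abs_mult)
      qed
      also have "\<dots> = W * C * (1 / (s * (1 - s)))"
        unfolding W_def by (simp add: sum_distrib_right sum_divide_distrib)
      also have "\<dots> \<le> W * C * \<bar>D\<bar>"
        by (intro mult_left_mono D W)
      finally have "\<bar>N\<bar> \<le> W * C * \<bar>D\<bar>" .
      moreover have "0 < \<bar>D\<bar>"
        using D ss by (meson less_le_trans zero_less_divide_1_iff)
      ultimately have "\<bar>N / D\<bar> \<le> W * C"
        by (simp add: divide_le_eq)
      then show ?thesis
        using r by simp
    qed
  qed
  then show ?thesis
    by (rule that)
qed

text \<open>The bound K serves the inner and the outer supremum; the given y also shows that the
  inner index set is nonempty.\<close>

lemma ext_lebesgue_ge: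
  assumes "h > 0" "1 \<le> d" "d \<le> n" "t \<in> {node x0 h 0..node x0 h (int n)}" "max_norm n y = 1"
  shows "\<bar>ext_fh_interp x0 h n d d d y t\<bar> \<le> ext_lebesgue x0 h n d d d"
proof -
  obtain K where K: "\<And>t y. t \<in> {node x0 h 0..node x0 h (int n)} \<Longrightarrow> max_norm n y = 1
      \<Longrightarrow> \<bar>ext_fh_interp x0 h n d d d y t\<bar> \<le> K"
    using ext_fh_interp_bounded[OF assms(1-3), where ?x0.0 = x0] by blast
  have "\<bar>ext_fh_interp x0 h n d d d y t\<bar> \<le> (SUP y\<in>{y. max_norm n y = 1}. \<bar>ext_fh_interp x0 h n d d d y t\<bar>)"
    using K assms by (intro cSUP_upper bdd_aboveI2[where M = K]) auto
  also have "\<dots> \<le> ext_lebesgue x0 h n d d d"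
    unfolding ext_lebesgue_def
  proof (rule cSUP_upper[OF assms(4)], rule bdd_aboveI2[where M = K])
    fix t assume "t \<in> {node x0 h 0..node x0 h (int n)}"
    then show "(SUP y\<in>{y. max_norm n y = 1}. \<bar>ext_fh_interp x0 h n d d d y t\<bar>) \<le> K"
      using K assms(5) by (intro cSUP_least) auto
  qed
  finally show ?thesis .
qed

section \<open>The test data and the lower bound\<close>

lemma kappa_pos:
  assumes "2 \<le> d"
  shows "0 < kappa d"
proof -
  \<comment> \<open>Clearing denominators, positivity reads (d + 2) 2^d < 4^d + 1. At d = 2 the
    estimate here is an equality, and the summand 1 gives strictness.\<close>
  have "real d + 2 \<le> 2 ^ d"
    using assms by (induction d rule: dec_induct) auto
  then have "(real d + 2) * 2 ^ d \<le> 2 ^ d * 2 ^ d"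
    by (intro mult_right_mono) auto
  moreover have "1 < (2 :: real) ^ d"
    using assms by (simp add: one_less_power)
  ultimately show ?thesis
    by (simp add: kappa_def power_int_minus field_simps)
qed

text \<open>For k <= d this is (-1)^k times the sign of t - k for every t in (0, 1), so one data
  vector serves all such t. Only k = 0 lies to the left of t, hence the separate case.\<close>

definition zigzag :: "nat \<Rightarrow> nat \<Rightarrow> real" where
  "zigzag d k = (if k = 0 then 1 else if k \<le> d then (-1) ^ (k + 1) else 0)"

lemma max_norm_zigzag: "max_norm n (zigzag d) = 1"
  unfolding max_norm_def by (intro Max_eqI) (auto simp: zigzag_def power_abs intro!: image_eqI[of _ _ 0])

lemma zigzag_sign:
  assumes "0 < t" "t < 1"
  shows "0 \<le> (-1) ^ k * zigzag d k / (t - real k)"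
  using assms by (auto simp: zigzag_def divide_nonpos_nonpos simp flip: power_add)

text \<open>Since \<open>(-1) ^ d * nodal d t\<close> is positive on (0, 1), each value has the sign
  of its Lagrange basis polynomial at t.\<close>

lemma interp_poly_zigzag:
  assumes "0 < t" "t < 1" "1 \<le> d"
  shows "poly (interp_poly d (zigzag d)) t = lebfun d t"
  unfolding poly_interp_poly lebfun_def
proof (rule sum.cong)
  fix k assume k: "k \<in> {..d}"
  have "t \<noteq> real k"
    using assms(1,2) by (cases k) auto
  then have "zigzag d k * poly (lagr d k) t
      = ((-1) ^ k * zigzag d k / (t - real k)) * ((-1) ^ d * nodal d t * real (d choose k) / fact d)"
    using k by (simp add: poly_lagr power_add mult_ac)
  also have "\<dots> \<ge> 0"
    using less_imp_le[OF nodal_unit_interval(1)[OF assms]] assms(1,2)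
    by (intro mult_nonneg_nonneg[OF zigzag_sign divide_nonneg_pos] mult_nonneg_nonneg[of "_ * nodal d t"]) auto
  finally have "zigzag d k * poly (lagr d k) t = \<bar>zigzag d k * poly (lagr d k) t\<bar>"
    by simp
  moreover have "\<bar>zigzag d k\<bar> = 1"
    using k by (simp add: zigzag_def power_abs)
  ultimately show "zigzag d k * poly (lagr d k) t = \<bar>poly (lagr d k) t\<bar>"
    by (simp add: abs_mult)
qed simp

lemma ext_fh_interp_zigzag:
  fixes t :: real
  assumes "h > 0" "2 \<le> d" "d < n" "0 < t" "t < 1"
  shows "kappa d * lebfun d t \<le> ext_fh_interp x0 h n d d d (zigzag d) (x0 + t * h)"
proof -
  define u where "u = t + real d"
  \<comment> \<open>Extended values are numbered from the leftmost node, so x_0 has index d.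
    \<open>P a\<close> below is the local interpolant of window a at t.\<close>
  define v where "v a = ext_val x0 h n d d (zigzag d) (int a - int d)" for a
  define P where "P a = poly (interp_poly d (\<lambda>j. v (a + j))) (u - real a)" for a
  define L where "L = lebfun d t"
  define b where "b a = blend d a u" for a
  have du: "real d < u" "u < real d + 1"
    using assms by (auto simp: u_def)
  have u: "u \<notin> \<nat>"
    by (rule not_Nats_between[OF du])
  have pos: "0 < b a" if "a \<le> Suc d" for a
    using blend_pos[OF du, of d a] assms that by (simp add: b_def)
  have L: "1 \<le> L"
    by (simp add: L_def lebfun_ge_1)
  have h: "h \<noteq> 0" and dn: "d \<le> n"
    using assms by auto

  have mid: "v (a + j) = zigzag d (a + j - d)" if "d \<le> a + j" "a + j - d \<le> n" for a j
  proof -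
    have "int (a + j) - int d = int (a + j - d)"
      using that by linarith
    then show ?thesis
      unfolding v_def ext_val_eq[OF h dn] using that by (simp del: of_nat_add of_nat_diff)
  qed
  \<comment> \<open>For a <= d a window sees only the left extension and y_0, ..., y_d, all values
    of one polynomial.\<close>
  have P_left: "P a = L" if "a \<le> d" for a
  proof -
    have "v (a + j) = poly (interp_poly d (zigzag d)) (real a - real d + real j)" if "j \<le> d" for j
    proof (cases "a + j < d")
      case True
      then show ?thesis
        by (simp add: v_def ext_val_eq[OF h dn] algebra_simps)
    next
      case False
      then show ?thesis
        using poly_interp_poly_node[of "a + j - d" d "zigzag d"] mid[of a j] \<open>a \<le> d\<close> that assms
        by (simp add: of_nat_diff algebra_simps)
    qed
    then have "P a = poly (interp_poly d (zigzag d)) (real a - real d + (u - real a))"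
      unfolding P_def by (intro interp_poly_of_poly degree_interp_poly)
    then show ?thesis
      using assms by (simp add: u_def interp_poly_zigzag L_def)
  qed
  \<comment> \<open>These windows contain original nodes only. Returning to the barycentric sum
    leaves terms with (-1)^k y_k / (t - k), nonnegative by \<open>zigzag_sign\<close>.\<close>
  have P_mid: "0 \<le> b a * P a" if "d \<le> a" "a \<le> n" for a
  proof -
    have ne: "u - real a \<noteq> real j" for j
      using u of_nat_in_Nats[of "a + j"] by (auto simp: algebra_simps)
    have "b a * P a = (-1) ^ a / fact d * (fact d / nodal d (u - real a) * P a)"
      by (simp add: b_def blend_def)
    also have "\<dots> = (-1) ^ a / fact d * (\<Sum>j\<le>d. (-1) ^ (d + j) * real (d choose j) * v (a + j) / (u - real a - real j))"
      unfolding P_def using ne by (subst barycentric_sum) auto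
    also have "\<dots> = (\<Sum>j\<le>d. ((-1) ^ (a + j - d) * zigzag d (a + j - d) / (t - real (a + j - d))) * (real (d choose j) / fact d))"
      unfolding sum_distrib_left
    proof (rule sum.cong)
      fix j assume "j \<in> {..d}"
      then have j: "v (a + j) = zigzag d (a + j - d)" "u - real a - real j = t - real (a + j - d)"
        using mid[of a j] that by (auto simp: u_def of_nat_diff)
      have "(-1 :: real) ^ a * (-1) ^ (d + j) = (-1) ^ (a + j - d)"
        using that by (auto simp: minus_one_power_iff)
      then show "(-1) ^ a / fact d * ((-1) ^ (d + j) * real (d choose j) * v (a + j) / (u - real a - real j))
          = ((-1) ^ (a + j - d) * zigzag d (a + j - d) / (t - real (a + j - d))) * (real (d choose j) / fact d)"
        unfolding j by (simp add: mult.assoc[symmetric]) (simp add: mult_ac)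
    qed simp
    also have "\<dots> \<ge> 0"
      using assms by (intro sum_nonneg mult_nonneg_nonneg zigzag_sign) auto
    finally show ?thesis .
  qed
  define q where "q = interp_poly d (\<lambda>j. zigzag d (n - d + j))"
  \<comment> \<open>From a = n on, a window sees only the last d + 1 original values and the right
    extension, all on q.\<close>
  have P_right: "P a = poly q (u - real n)" if "n \<le> a" for a
  proof -
    have "v (a + j) = poly q (real a - real n + real j)" if "j \<le> d" for j
    proof (cases "a + j - d \<le> n")
      case True
      have "v (a + j) = zigzag d (a + j - d)"
        using mid[of a j] True \<open>n \<le> a\<close> dn by simp
      also have "a + j - d = n - d + (a + j - n)"
        using \<open>n \<le> a\<close> dn by simp
      also have "zigzag d (n - d + (a + j - n)) = poly q (real (a + j - n))"
        unfolding q_def using True by (intro poly_interp_poly_node[symmetric]) simp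
      also have "real (a + j - n) = real a - real n + real j"
        using \<open>n \<le> a\<close> by simp
      finally show ?thesis .
    next
      case False
      define i where "i = int (a + j) - int d"
      have "int n < i" "0 \<le> i"
        using False by (simp_all add: i_def)
      then have "v (a + j) = poly q (of_int i - real (n - d))"
        unfolding v_def ext_val_eq[OF h dn] q_def i_def[symmetric] by simp
      also have "of_int i - real (n - d) = real a - real n + real j"
        using dn by (simp add: i_def)
      finally show ?thesis .
    qed
    then have "P a = poly q (real a - real n + (u - real a))"
      unfolding P_def by (intro interp_poly_of_poly) (simp_all add: q_def degree_interp_poly)
    then show ?thesis
      by simp
  qed

  define S where "S = (\<Sum>a\<le>d. b a)"
  have split: "(\<Sum>a\<le>n + d. f a) = (\<Sum>a\<le>d. f a) + (\<Sum>a=Suc d..n + d. f a)" for f :: "nat \<Rightarrow> real"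
  proof -
    have "{..n + d} = {..d} \<union> {Suc d..n + d}"
      by auto
    then show ?thesis
      by (simp add: sum.union_disjoint disjoint_iff)
  qed
  have split': "(\<Sum>a=Suc d..n + d. f a) = (\<Sum>a=Suc d..<n. f a) + (\<Sum>a=n..n + d. f a)" for f :: "nat \<Rightarrow> real"
  proof -
    have "{Suc d..n + d} = {Suc d..<n} \<union> {n..n + d}"
      using assms by auto
    then show ?thesis
      by (simp add: sum.union_disjoint disjoint_iff)
  qed
  have un: "u < real n"
    using du assms(3) by linarith

  have "0 \<le> (\<Sum>a=Suc d..<n. b a * P a)"
    by (intro sum_nonneg P_mid) auto
  moreover have "(\<Sum>a=n..n + d. b a * P a) = poly q (u - real n) * (\<Sum>a=n..n + d. blend d a u)"
    by (simp add: P_right b_def sum_distrib_left mult.commute)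
  \<comment> \<open>The window a = n is of the middle and of the right kind, which fixes the sign of
    the first term. The common value of q, of unknown sign, then acts as c in
    \<open>blend_tail\<close>.\<close>
  moreover have "0 \<le> poly q (u - real n) * blend d n u"
    using P_mid[of n] P_right[of n] assms by (simp add: b_def mult.commute)
  then have "0 \<le> poly q (u - real n) * (\<Sum>a=n..n + d. blend d a u)"
    using u un by (intro blend_tail) auto
  moreover have "(\<Sum>a\<le>d. b a * P a) = S * L"
    by (simp add: P_left S_def sum_distrib_right)
  ultimately have N: "S * L \<le> (\<Sum>a\<le>n + d. b a * P a)"
    by (simp add: split split')

  \<comment> \<open>The coefficient d + 1 is t / (d + 1 - t) times coefficient d, so the whole tail
    adds at most \<open>b d\<close> to S.\<close>
  have "b (Suc d) * (1 - t + real d) = b d * t"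
    using blend_step[OF u, of d d] by (simp add: b_def u_def algebra_simps)
  moreover have "b (Suc d) * 1 \<le> b (Suc d) * (1 - t + real d)"
    using pos[of "Suc d"] assms by (intro mult_left_mono) auto
  moreover have "b d * t \<le> b d"
    using pos[of d] assms by (simp add: mult_left_le)
  ultimately have b1: "b (Suc d) \<le> b d"
    by linarith
  have "0 \<le> 1 * (\<Sum>a=Suc d..n + d. blend d a u)" "1 * (\<Sum>a=Suc d..n + d. blend d a u) \<le> 1 * blend d (Suc d) u"
    using less_imp_le[OF pos[of "Suc d"]] u du assms by (intro blend_tail; simp add: b_def)+
  then have D: "S \<le> (\<Sum>a\<le>n + d. b a)" "(\<Sum>a\<le>n + d. b a) \<le> S + b d"
    using b1 by (simp_all add: split S_def b_def)
  have S: "0 < S"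
    unfolding S_def using pos by (intro sum_pos) auto

  have two: "1 < (2 :: real) ^ d"
    using assms by (simp add: one_less_power)
  \<comment> \<open>With \<open>b d\<close> at most \<rho> S the denominator is at most (1 + \<rho>)
    S, and (1 - \<rho>) (1 + \<rho>) <= 1.\<close>
  define \<rho> where "\<rho> = real d / (2 ^ d - 1)"
  have "(2 ^ d - 1) * b d \<le> real d * S"
    using blend_main_sum_ge[of t d] assms by (simp add: b_def S_def u_def)
  then have b: "b d \<le> \<rho> * S"
    using two by (simp add: \<rho>_def field_simps)
  have \<kappa>: "0 < kappa d" "kappa d \<le> 1 - \<rho>"
    using kappa_pos[OF assms(2)] by (simp_all add: kappa_def \<rho>_def power_int_minus)
  have \<rho>: "0 \<le> \<rho>"
    using two by (simp add: \<rho>_def)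
  have "kappa d * (\<Sum>a\<le>n + d. b a) \<le> kappa d * ((1 + \<rho>) * S)"
    using D b \<kappa> by (intro mult_left_mono) (auto simp: algebra_simps)
  also have "\<dots> \<le> (1 - \<rho>) * ((1 + \<rho>) * S)"
    using \<kappa> \<rho> S by (intro mult_right_mono) auto
  also have "\<dots> = S - \<rho>\<^sup>2 * S"
    by (simp add: algebra_simps power2_eq_square)
  also have "\<dots> \<le> S"
    using S by simp
  finally have "kappa d * (\<Sum>a\<le>n + d. b a) * L \<le> S * L"
    using L by (intro mult_right_mono) auto
  also note N
  finally have "kappa d * L \<le> (\<Sum>a\<le>n + d. b a * P a) / (\<Sum>a\<le>n + d. b a)"
    using D S by (simp add: pos_le_divide_eq mult_ac)
  then show ?thesis
    using ext_fh_interp_blend[of h t d] u h by (simp add: u_def b_def P_def v_def L_def)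
qed

theorem theorem1:
  fixes n d :: nat and x0 h :: real
  assumes "n > d + 1" and "d + 1 \<ge> 3" and "h > 0"
  shows "ext_lebesgue x0 h n d d d \<ge> kappa d * poly_lebesgue d"
proof -
  let ?E = "ext_lebesgue x0 h n d d d"
  have d: "2 \<le> d"
    using assms by simp
  have \<kappa>: "0 < kappa d"
    by (rule kappa_pos[OF d])
  \<comment> \<open>After normalisation the polynomial is bounded by the Lebesgue function at t,
    hence by its value at some s in (0, 1), which the zigzag data recover up to
    \<open>kappa d\<close>.\<close>
  have bound: "\<bar>poly (interp_poly d y) t\<bar> / max_norm d y \<le> ?E / kappa d"
    if t: "0 \<le> t" "t \<le> real d" and y: "\<exists>i\<in>{0..d}. y i \<noteq> 0" for t y
  proof -
    obtain i where "i \<le> d" "y i \<noteq> 0"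
      using y by auto
    then have norm: "0 < max_norm d y"
      using abs_le_max_norm[of i d y] by linarith
    obtain s where s: "0 < s" "s < 1" "lebfun d t \<le> lebfun d s"
      using lebfun_bounded_by_first_interval[OF t] by blast
    have "\<bar>poly (interp_poly d y) t\<bar> \<le> max_norm d y * lebfun d t"
      by (intro abs_interp_poly_le abs_le_max_norm)
    then have "\<bar>poly (interp_poly d y) t\<bar> / max_norm d y \<le> lebfun d t"
      using norm by (simp add: divide_le_eq mult.commute)
    also note s(3)
    finally have "kappa d * (\<bar>poly (interp_poly d y) t\<bar> / max_norm d y) \<le> kappa d * lebfun d s"
      using \<kappa> by (intro mult_left_mono) auto
    also have "\<dots> \<le> ext_fh_interp x0 h n d d d (zigzag d) (x0 + s * h)"
      using s assms d by (intro ext_fh_interp_zigzag) auto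
    also have "\<dots> \<le> \<bar>ext_fh_interp x0 h n d d d (zigzag d) (x0 + s * h)\<bar>"
      by simp
    also have "\<dots> \<le> ?E"
    proof (rule ext_lebesgue_ge)
      have "s * h \<le> real n * h"
        using s assms by (intro mult_right_mono) auto
      then show "x0 + s * h \<in> {node x0 h 0..node x0 h (int n)}"
        using s assms by (simp add: node_def)
    qed (use assms in \<open>auto simp: max_norm_zigzag\<close>)
    finally show ?thesis
      using \<kappa> by (simp add: pos_le_divide_eq mult.commute)
  qed
  have "poly_lebesgue d \<le> ?E / kappa d"
    unfolding poly_lebesgue_def
  \<comment> \<open>The index set is nonempty: constant data 1 at t = 0.\<close>
  proof (rule cSUP_least)
    have "(0, \<lambda>_. 1) \<in> {0..real d} \<times> {y. \<exists>i\<in>{0..d}. y i \<noteq> (0 :: real)}"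
      by auto
    then show "{0..real d} \<times> {y. \<exists>i\<in>{0..d}. y i \<noteq> (0 :: real)} \<noteq> {}"
      unfolding ex_in_conv[symmetric] by (rule exI)
  next
    fix z assume z: "z \<in> {0..real d} \<times> {y. \<exists>i\<in>{0..d}. y i \<noteq> (0 :: real)}"
    obtain t y where ty: "z = (t, y)"
      by (cases z)
    have "0 \<le> t" "t \<le> real d" "\<exists>i\<in>{0..d}. y i \<noteq> 0"
      using z unfolding ty by simp_all
    from bound[OF this]
    show "(case z of (t, y) \<Rightarrow> \<bar>poly (interp_poly d y) t\<bar> / max_norm d y) \<le> ?E / kappa d"
      by (simp add: ty)
  qed
  then show ?thesis
    using \<kappa> by (simp add: pos_le_divide_eq mult.commute)
qed

end
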